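(* Let $P \subseteq \mathbb{R}^n$ be a nonempty box-integer polyhedron and $\Phi: \mathbb{Z}^n \to \mathbb{R} \cup \{+\infty\}$ a separable convex function. Assume that $\inf\{\Phi(x) \mid x \in P \cap \mathbb{Z}^n\}$ is finite and attained by some $x^*$. Then $$\inf\{\Phi(x) \mid x \in P \cap \mathbb{Z}^n\} = \sup\{ \mu_P(p) - \Phi^\bullet(p) \mid p \in \mathbb{R}^n\}$$ and the supremum is attained by some $p^* \in \mathbb{R}^n$. If, in addition, $\Phi$ is integer-valued, then $$\inf\{\Phi(x) \mid x \in P \cap \mathbb{Z}^n\} = \sup\{ \mu_P(p) - \Phi^\bullet(p) \mid p \in \mathbb{Z}^n\}$$ and this supremum is attained by some $p^* \in \mathbb{Z}^n$.
   Context: A polyhedron $P \subseteq \mathbb{R}^n$ is box-integer if $P \cap \{x \in \mathbb{R}^n \mid l \le x \le u\}$ is an integer polyhedron (equal to the convex hull of its integer points) for all integer vectors $l \le u$. $\Phi$ is separable convex if $\Phi(x) = \sum_{i=1}^n \varphi_i(x_i)$ with $\varphi_i: \mathbb{Z} \to \mathbb{R} \cup \{+\infty\}$ such that $\operatorname{dom}\varphi_i = \{k \mid \varphi_i(k) < +\infty\}$ is an interval of integers and $\varphi_i(k-1) + \varphi_i(k+1) \ge 2\varphi_i(k)$ for all $k \in \mathbb{Z}$. $\mu_P(p) = \inf\{\langle p,x\rangle \mid x \in P\}$ and $\Phi^\bullet(p) = \sup\{\langle p,x\rangle - \Phi(x) \mid x \in \mathbb{Z}^n\}$ for $p \in \mathbb{R}^n$.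 *)

theory Defs
  imports "HOL-Analysis.Analysis"
begin

definition int_vec :: "int ^ 'n \<Rightarrow> real ^ 'n" where
  "int_vec x = (\<chi> i. real_of_int (x $ i))"

definition integer_points :: "(real ^ 'n) set \<Rightarrow> (int ^ 'n) set" where
  "integer_points S = {x. int_vec x \<in> S}"

definition integer_polyhedron :: "(real ^ 'n) set \<Rightarrow> bool" where
  "integer_polyhedron S \<longleftrightarrow>
     polyhedron S \<and> S = convex hull (int_vec ` integer_points S)"

definition box_integer :: "(real ^ 'n) set \<Rightarrow> bool" where
  "box_integer P \<longleftrightarrow>
     (\<forall>l u :: int ^ 'n. l \<le> u \<longrightarrow>
        integer_polyhedron (P \<inter> {x. int_vec l \<le> x \<and> x \<le> int_vec u}))"

definition dom_int :: "(int \<Rightarrow> ereal) \<Rightarrow> int set" where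
  "dom_int \<phi> = {k. \<phi> k < \<infinity>}"

text \<open>Functions with values in the reals extended by plus infinity are \<^typ>\<open>ereal\<close>-valued
  functions avoiding minus infinity. An interval of integers is an order-convex set of integers
  (bounded or not).\<close>

definition discrete_convex :: "(int \<Rightarrow> ereal) \<Rightarrow> bool" where
  "discrete_convex \<phi> \<longleftrightarrow>
     (\<forall>k. \<phi> k \<noteq> -\<infinity>) \<and>
     (\<forall>a \<in> dom_int \<phi>. \<forall>b \<in> dom_int \<phi>. {a..b} \<subseteq> dom_int \<phi>) \<and>
     (\<forall>k. \<phi> (k - 1) + \<phi> (k + 1) \<ge> 2 * \<phi> k)"

definition separable_convex :: "(int ^ 'n \<Rightarrow> ereal) \<Rightarrow> bool" where
  "separable_convex \<Phi> \<longleftrightarrow>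
     (\<exists>\<phi> :: 'n \<Rightarrow> int \<Rightarrow> ereal.
        (\<forall>i. discrete_convex (\<phi> i)) \<and> (\<forall>x. \<Phi> x = (\<Sum>i\<in>UNIV. \<phi> i (x $ i))))"

text \<open>As for extended-real-valued functions generally, an integer-valued function may still take the
  value plus infinity.\<close>

definition integer_valued :: "(int ^ 'n \<Rightarrow> ereal) \<Rightarrow> bool" where
  "integer_valued \<Phi> \<longleftrightarrow> (\<forall>x. \<Phi> x = \<infinity> \<or> (\<exists>k :: int. \<Phi> x = ereal (real_of_int k)))"

definition \<mu> :: "(real ^ 'n) set \<Rightarrow> real ^ 'n \<Rightarrow> ereal" where
  "\<mu> P p = (INF x\<in>P. ereal (p \<bullet> x))"

definition convex_conj :: "(int ^ 'n \<Rightarrow> ereal) \<Rightarrow> real ^ 'n \<Rightarrow> ereal" where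
  "convex_conj \<Phi> p = (SUP x. ereal (p \<bullet> int_vec x) - \<Phi> x)"

text \<open>In \<^term>\<open>\<mu> P p - convex_conj \<Phi> p\<close> the form infinity minus infinity (or its negative
  counterpart) does not arise when \<^term>\<open>P\<close> is nonempty and \<^term>\<open>\<Phi>\<close> is finite somewhere:
  then the first term is below plus infinity and the second above minus infinity.\<close>

end

theory Submission
  imports Defs
begin

text \<open>At a minimizer \<open>x\<close> a dual certificate is a vector \<open>p\<close> lying between the one-sided slopes
  \<open>a \<le> b\<close> of \<open>\<Phi>\<close> at \<open>x\<close> with \<open>\<langle>p, z - x\<rangle> \<ge> 0\<close> for all \<open>z \<in> P\<close>; by box-integrality it suffices to
  consider integer points \<open>z\<close> of \<open>P\<close> with \<open>z - x \<in> {-1, 0, 1}\<^sup>n\<close>. Optimality of \<open>x\<close> says that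
  \<open>h(z - x) = \<Sum>\<^sub>i max (a\<^sub>i (z\<^sub>i - x\<^sub>i)) (b\<^sub>i (z\<^sub>i - x\<^sub>i)) \<ge> 0\<close> for these \<open>z\<close>. As in Fourier-Motzkin
  elimination, the interval \<open>[a\<^sub>j, b\<^sub>j]\<close> is shrunk to a point for one coordinate \<open>j\<close> after the other,
  keeping this condition. A lower bound from \<open>u\<close> with \<open>u\<^sub>j - x\<^sub>j = 1\<close> and an upper bound from \<open>v\<close> with
  \<open>v\<^sub>j - x\<^sub>j = -1\<close> are compatible because box-integrality writes the midpoint of \<open>u\<close> and \<open>v\<close> as a
  convex combination of integer points of \<open>P\<close> with \<open>j\<close>-th entry \<open>x\<^sub>j\<close> on which \<open>h\<close> is linear. All
  coefficients of the fixed coordinate being \<open>\<plusminus>1\<close>, integral slopes lead to an integral \<open>p\<close>.\<close>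

section \<open>Neighbouring integer points and directional bounds\<close>

definition near_points :: "(real ^ 'n) set \<Rightarrow> int ^ 'n \<Rightarrow> (int ^ 'n) set" where
  "near_points P x = {z \<in> integer_points P. \<forall>i. \<bar>z $ i - x $ i\<bar> \<le> 1}"

text \<open>The bounds are the floor and ceiling of the coordinates of \<open>(u + v) / 2\<close>:
  this is the integral neighbourhood of the midpoint.\<close>

definition mid_nbhd :: "int ^ 'n \<Rightarrow> int ^ 'n \<Rightarrow> (int ^ 'n) set" where
  "mid_nbhd u v = {z. \<forall>i. (u $ i + v $ i) div 2 \<le> z $ i \<and> z $ i \<le> (u $ i + v $ i + 1) div 2}"

text \<open>For \<open>a i \<le> b i\<close> this is the support function of the box with corners
  \<open>a\<close> and \<open>b\<close>: the maximum of \<open>p \<bullet> d\<close> over all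
  \<open>p\<close> in the box.\<close>

definition dir_bound :: "('n::finite \<Rightarrow> real) \<Rightarrow> ('n \<Rightarrow> real) \<Rightarrow> int ^ 'n \<Rightarrow> real" where
  "dir_bound a b d = (\<Sum>i\<in>UNIV. max (a i * of_int (d $ i)) (b i * of_int (d $ i)))"

text \<open>Lets real and integral dual vectors be treated at once: \<open>S\<close> is later
  \<open>UNIV\<close> for the former and \<open>\<int>\<close> for the latter.\<close>

definition real_subring :: "real set \<Rightarrow> bool" where
  "real_subring S \<longleftrightarrow> \<int> \<subseteq> S \<and> (\<forall>x\<in>S. \<forall>y\<in>S. x + y \<in> S \<and> x * y \<in> S)"

lemma int_vec_nth [simp]: "int_vec x $ i = of_int (x $ i)"
  by (simp add: int_vec_def)

lemma real_subring_uminus: "real_subring S \<Longrightarrow> x \<in> S \<Longrightarrow> - x \<in> S"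
proof -
  assume S: "real_subring S" and x: "x \<in> S"
  have "-1 \<in> S" using S Ints_minus[OF Ints_1] by (auto simp: real_subring_def)
  then have "(-1) * x \<in> S" using S x unfolding real_subring_def by blast
  then show ?thesis by simp
qed

lemma real_subring_sum:
  assumes "real_subring S" "\<And>i. i \<in> A \<Longrightarrow> f i \<in> S"
  shows "sum f A \<in> S"
proof -
  have "0 \<in> S" using assms(1) by (auto simp: real_subring_def)
  then show ?thesis
    using assms by (induction A rule: infinite_finite_induct) (auto simp: real_subring_def)
qed

lemma finite_near_points: "finite (near_points P (x :: int ^ 'n))"
proof -
  let ?B = "PiE UNIV (\<lambda>i. {x $ i - 1 .. x $ i + 1})"
  have "near_points P x \<subseteq> vec_lambda ` ?B"
  proof
    fix z assume "z \<in> near_points P x"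
    then have "vec_nth z \<in> ?B" by (auto simp: near_points_def abs_le_iff PiE_iff) (smt (verit))+
    then show "z \<in> vec_lambda ` ?B" by (metis imageI vec_nth_inverse)
  qed
  moreover have "finite (vec_lambda ` ?B)" by (intro finite_imageI finite_PiE) auto
  ultimately show ?thesis by (rule finite_subset)
qed

section \<open>Box-integrality and midpoints\<close>

lemma box_integer_hull:
  assumes "box_integer P" "l \<le> u" "y \<in> P" "int_vec l \<le> y" "y \<le> int_vec u"
  shows "y \<in> convex hull (int_vec ` {z \<in> integer_points P. l \<le> z \<and> z \<le> u})"
proof -
  let ?B = "P \<inter> {x. int_vec l \<le> x \<and> x \<le> int_vec u}"
  have "?B = convex hull (int_vec ` integer_points ?B)"
    using assms by (auto simp: box_integer_def integer_polyhedron_def)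
  moreover have "integer_points ?B = {z \<in> integer_points P. l \<le> z \<and> z \<le> u}"
    by (auto simp: integer_points_def less_eq_vec_def)
  ultimately show ?thesis using assms by auto
qed

text \<open>Rounding the midpoint down and up gives an integral box around it. Both roundings stay
  within distance 1 of \<open>x\<close> in each coordinate because \<open>u\<close> and
  \<open>v\<close> do, so box-integrality yields only points near \<open>x\<close>.\<close>

lemma midpoint_in_hull:
  assumes "convex P" "box_integer P" "u \<in> near_points P x" "v \<in> near_points P x"
  shows "midpoint (int_vec u) (int_vec v) \<in> convex hull (int_vec ` (near_points P x \<inter> mid_nbhd u v))"
proof -
  let ?l = "\<chi> i. (u $ i + v $ i) div 2" and ?m = "\<chi> i. (u $ i + v $ i + 1) div 2"
  let ?y = "midpoint (int_vec u) (int_vec v)"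
  have 1: "?l \<le> ?m" by (auto simp: less_eq_vec_def)
  have 2: "?y \<in> P"
    using assms by (auto simp: near_points_def integer_points_def midpoint_def scaleR_right_distrib intro!: convexD[OF assms(1)])
  have yi: "?y $ i = of_int (u $ i + v $ i) / 2" for i
    by (simp add: midpoint_def)
  have 3: "int_vec ?l \<le> ?y" "?y \<le> int_vec ?m"
    unfolding less_eq_vec_def yi by (auto; linarith)+
  have "?y \<in> convex hull (int_vec ` {z \<in> integer_points P. ?l \<le> z \<and> z \<le> ?m})"
    using box_integer_hull[OF assms(2) 1 2 3] .
  moreover have "{z \<in> integer_points P. ?l \<le> z \<and> z \<le> ?m} \<subseteq> near_points P x \<inter> mid_nbhd u v"
  proof
    fix z assume z: "z \<in> {z \<in> integer_points P. ?l \<le> z \<and> z \<le> ?m}"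
    then have nb: "z \<in> mid_nbhd u v" by (auto simp: mid_nbhd_def less_eq_vec_def)
    have "\<bar>z $ i - x $ i\<bar> \<le> 1" for i
    proof -
      have "\<bar>u $ i - x $ i\<bar> \<le> 1" "\<bar>v $ i - x $ i\<bar> \<le> 1"
        using assms(3,4) by (auto simp: near_points_def)
      moreover have "(u $ i + v $ i) div 2 \<le> z $ i" "z $ i \<le> (u $ i + v $ i + 1) div 2"
        using nb by (auto simp: mid_nbhd_def)
      ultimately show ?thesis by linarith
    qed
    then show "z \<in> near_points P x \<inter> mid_nbhd u v" using z nb by (auto simp: near_points_def)
  qed
  ultimately show ?thesis by (meson hull_mono image_mono subsetD)
qed

text \<open>On the integral neighbourhood of the midpoint, \<^const>\<open>dir_bound\<close> is linear, so its
  nonnegativity passes to the midpoint; subadditivity then bounds the sum below.\<close>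

lemma dir_bound_add_nonneg:
  assumes P: "convex P" "box_integer P"
    and ab: "\<And>i. a i \<le> b i"
    and pos: "\<And>z. z \<in> near_points P x \<Longrightarrow> z $ j = x $ j \<Longrightarrow> dir_bound a b (z - x) \<ge> 0"
    and uv: "u \<in> near_points P x" "v \<in> near_points P x" "u $ j + v $ j = 2 * x $ j"
  shows "dir_bound a b (u - x) + dir_bound a b (v - x) \<ge> 0"
proof -
  \<comment> \<open>On \<open>mid_nbhd u v\<close> the entry \<open>z $ i - x $ i\<close> has weakly
    the sign of \<open>u $ i + v $ i - 2 * x $ i\<close>, so one choice of slopes attains the
    maximum in every summand.\<close>
  define c :: "real ^ 'a" where "c = (\<chi> i. if u $ i + v $ i \<ge> 2 * x $ i then b i else a i)"
  have c: "max (a i * of_int k) (b i * of_int k) = c $ i * of_int k"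
    if "u $ i + v $ i \<ge> 2 * x $ i \<Longrightarrow> k \<ge> 0" "u $ i + v $ i < 2 * x $ i \<Longrightarrow> k \<le> 0" for i k
  proof (cases "u $ i + v $ i \<ge> 2 * x $ i")
    case True
    then have "a i * of_int k \<le> b i * of_int k" using that ab[of i] by (intro mult_right_mono) auto
    then show ?thesis using True by (simp add: c_def max_def)
  next
    case False
    then have "b i * of_int k \<le> a i * of_int k"
      using that ab[of i] by (intro mult_right_mono_neg) auto
    then show ?thesis using False by (simp add: c_def max_def)
  qed
  have "int_vec ` (near_points P x \<inter> mid_nbhd u v) \<subseteq> {y. c \<bullet> y \<ge> c \<bullet> int_vec x}"
  proof clarify
    fix z assume z: "z \<in> near_points P x" and nb: "z \<in> mid_nbhd u v"
    have nb: "(u $ i + v $ i) div 2 \<le> z $ i" "z $ i \<le> (u $ i + v $ i + 1) div 2" for i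
      using nb by (auto simp: mid_nbhd_def)
    \<comment> \<open>Both roundings of the midpoint agree at \<open>j\<close>, where its coordinate
      is the integer \<open>x $ j\<close>.\<close>
    have "z $ j = x $ j" using nb[of j] uv(3) by simp
    then have "0 \<le> dir_bound a b (z - x)" using pos z by blast
    also have "\<dots> = (\<Sum>i\<in>UNIV. c $ i * of_int ((z - x) $ i))"
      unfolding dir_bound_def
    proof (intro sum.cong refl c)
      fix i
      show "(z - x) $ i \<ge> 0" if "u $ i + v $ i \<ge> 2 * x $ i"
        using that nb(1)[of i] by (simp; linarith)
      show "(z - x) $ i \<le> 0" if "u $ i + v $ i < 2 * x $ i"
        using that nb(2)[of i] by (simp; linarith)
    qed
    also have "\<dots> = c \<bullet> int_vec z - c \<bullet> int_vec x"
      by (simp add: inner_vec_def algebra_simps sum_subtractf)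
    finally show "c \<bullet> int_vec x \<le> c \<bullet> int_vec z" by simp
  qed
  then have "convex hull (int_vec ` (near_points P x \<inter> mid_nbhd u v)) \<subseteq> {y. c \<bullet> y \<ge> c \<bullet> int_vec x}"
    by (intro hull_minimal convex_halfspace_ge)
  then have "c \<bullet> midpoint (int_vec u) (int_vec v) \<ge> c \<bullet> int_vec x"
    using midpoint_in_hull[OF P uv(1,2)] by blast
  then have "0 \<le> c \<bullet> (int_vec u + int_vec v) - 2 * (c \<bullet> int_vec x)"
    by (simp add: midpoint_def)
  also have "\<dots> = (\<Sum>i\<in>UNIV. c $ i * of_int (u $ i + v $ i - 2 * x $ i))"
    by (simp add: inner_vec_def algebra_simps sum_subtractf sum.distrib sum_distrib_left)
  also have "\<dots> = (\<Sum>i\<in>UNIV. max (a i * of_int (u $ i + v $ i - 2 * x $ i)) (b i * of_int (u $ i + v $ i - 2 * x $ i)))"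
    by (intro sum.cong refl c[symmetric]) auto
  also have "\<dots> \<le> dir_bound a b (u - x) + dir_bound a b (v - x)"
    unfolding dir_bound_def sum.distrib[symmetric]
    by (intro sum_mono) (auto simp: max_def algebra_simps)
  finally show ?thesis .
qed

section \<open>Elimination of one coordinate after the other\<close>

text \<open>Equal bounds at \<open>j\<close> make that summand linear; bounds \<open>0\<close> serve
  to delete it.\<close>

lemma dir_bound_fun_upd:
  "dir_bound (a(j := t)) (b(j := t)) d =
     t * of_int (d $ j) + dir_bound (a(j := 0)) (b(j := 0)) d"
proof -
  have "dir_bound (a(j := s)) (b(j := s)) d = s * of_int (d $ j) +
      (\<Sum>i\<in>UNIV - {j}. max (a i * of_int (d $ i)) (b i * of_int (d $ i)))" for s
    unfolding dir_bound_def by (subst sum.remove[of _ j]) auto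
  from this[of t] this[of 0] show ?thesis by simp
qed

lemma dir_bound_split:
  "dir_bound a b d = max (a j * of_int (d $ j)) (b j * of_int (d $ j)) + dir_bound (a(j := 0)) (b(j := 0)) d"
  unfolding dir_bound_def by (subst (1 2) sum.remove[of _ j]) auto

text \<open>With \<open>d = z - x\<close>, the condition bounds \<open>t\<close> from below if
  \<open>d $ j = 1\<close>, from above if \<open>d $ j = -1\<close>, and not at all if
  \<open>d $ j = 0\<close>. The largest lower bound works; it lies in \<open>S\<close> since no
  division occurs.\<close>

lemma fix_coordinate:
  assumes P: "convex P" "box_integer P"
    and S: "real_subring S"
    and ab: "\<And>i. a i \<le> b i" "\<And>i. a i \<in> S" "\<And>i. b i \<in> S"
    and pos: "\<And>z. z \<in> near_points P x \<Longrightarrow> dir_bound a b (z - x) \<ge> 0"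
  obtains t where "t \<in> S" "a j \<le> t" "t \<le> b j"
    "\<And>z. z \<in> near_points P x \<Longrightarrow> dir_bound (a(j := t)) (b(j := t)) (z - x) \<ge> 0"
proof -
  define r where "r z = dir_bound (a(j := 0)) (b(j := 0)) (z - x)" for z
  define L where "L = insert (a j) ((\<lambda>z. - r z) ` {z \<in> near_points P x. z $ j - x $ j = 1})"
  define t where "t = Max L"
  have L: "finite L" "L \<noteq> {}" using finite_near_points[of P x] by (auto simp: L_def)
  have tL: "t \<in> L" unfolding t_def using L by (rule Max_in)
  have tge: "s \<le> t" if "s \<in> L" for s using that L by (simp add: t_def)
  have zero: "0 \<in> S" using S by (auto simp: real_subring_def)
  have rS: "r z \<in> S" for z
    unfolding r_def dir_bound_def
  proof (intro real_subring_sum[OF S])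
    fix i
    let ?k = "of_int ((z - x) $ i) :: real"
    have "?k \<in> S" using S by (auto simp: real_subring_def)
    then have "(a(j := 0)) i * ?k \<in> S" "(b(j := 0)) i * ?k \<in> S"
      using ab zero S unfolding real_subring_def by auto
    then show "max ((a(j := 0)) i * ?k) ((b(j := 0)) i * ?k) \<in> S" by (simp add: max_def)
  qed
  have h: "dir_bound a b (z - x) = max (a j * of_int (z $ j - x $ j)) (b j * of_int (z $ j - x $ j)) + r z" for z
    using dir_bound_split[of a b "z - x" j] by (simp add: r_def)
  have r0: "r z \<ge> 0" if "z \<in> near_points P x" "z $ j = x $ j" for z
    using pos[OF that(1)] h[of z] that(2) by simp
  \<comment> \<open>Together with \<open>a j \<le> b j\<close>, the facts \<open>r1\<close>,
    \<open>r2\<close> and \<open>r12\<close> compare every lower bound for \<open>t\<close> with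
    every upper bound.\<close>
  have r1: "- r z \<le> b j" if "z \<in> near_points P x" "z $ j - x $ j = 1" for z
    using pos[OF that(1)] h[of z] that(2) ab(1)[of j] by (simp add: max_def)
  have r2: "a j \<le> r z" if "z \<in> near_points P x" "z $ j - x $ j = -1" for z
    using pos[OF that(1)] h[of z] that(2) ab(1)[of j] by (simp add: max_def split: if_splits)
  have r12: "- r u \<le> r v"
    if "u \<in> near_points P x" "u $ j - x $ j = 1" "v \<in> near_points P x" "v $ j - x $ j = -1" for u v
  proof -
    have "r u + r v \<ge> 0"
      unfolding r_def
    proof (rule dir_bound_add_nonneg[OF P])
      show "(a(j := 0)) i \<le> (b(j := 0)) i" for i using ab by simp
      show "dir_bound (a(j := 0)) (b(j := 0)) (z - x) \<ge> 0" if "z \<in> near_points P x" "z $ j = x $ j" for z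
        using r0[OF that] by (simp add: r_def)
      show "u $ j + v $ j = 2 * x $ j" using that by simp
    qed (use that in auto)
    then show ?thesis by simp
  qed
  show ?thesis
  proof (rule that)
    show "t \<in> S" using tL ab rS real_subring_uminus[OF S] by (auto simp: L_def)
    show "a j \<le> t" by (rule tge) (simp add: L_def)
    show "t \<le> b j" using tL ab(1)[of j] r1 by (auto simp: L_def)
    fix z assume z: "z \<in> near_points P x"
    have eq: "dir_bound (a(j := t)) (b(j := t)) (z - x) = t * of_int (z $ j - x $ j) + r z"
      using dir_bound_fun_upd[of a j t b "z - x"] by (simp add: r_def)
    have "\<bar>z $ j - x $ j\<bar> \<le> 1" using z by (auto simp: near_points_def)
    then consider "z $ j - x $ j = 0" | "z $ j - x $ j = 1" | "z $ j - x $ j = -1" by linarith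
    then show "dir_bound (a(j := t)) (b(j := t)) (z - x) \<ge> 0"
    proof cases
      case 1
      then show ?thesis using eq r0[OF z] by simp
    next
      case 2
      then have "- r z \<le> t" using z by (intro tge) (auto simp: L_def)
      then show ?thesis using eq 2 by simp
    next
      case 3
      then have "t \<le> r z" using tL r2 r12 z by (auto simp: L_def)
      then show ?thesis using eq 3 by simp
    qed
  qed
qed

text \<open>Once all coordinates are fixed the two bounds coincide, and \<open>dir_bound\<close>
  becomes the inner product with \<open>p\<close>. The induction runs over the set \<open>F\<close>
  of coordinates already fixed.\<close>

lemma ex_normal_on_near_points:
  fixes a b :: "'n::finite \<Rightarrow> real"
  assumes P: "convex P" "box_integer P"
    and S: "real_subring S"
    and ab: "\<And>i. a i \<le> b i" "\<And>i. a i \<in> S" "\<And>i. b i \<in> S"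
    and pos: "\<And>z. z \<in> near_points P x \<Longrightarrow> dir_bound a b (z - x) \<ge> 0"
  obtains p :: "real ^ 'n" where "\<And>i. p $ i \<in> S" "\<And>i. a i \<le> p $ i" "\<And>i. p $ i \<le> b i"
    "\<And>z. z \<in> near_points P x \<Longrightarrow> p \<bullet> int_vec x \<le> p \<bullet> int_vec z"
proof -
  have "\<exists>a' b'. (\<forall>i. a' i \<le> b' i \<and> a' i \<in> S \<and> b' i \<in> S \<and> a i \<le> a' i \<and> b' i \<le> b i) \<and>
      (\<forall>i\<in>F. a' i = b' i) \<and> (\<forall>z\<in>near_points P x. dir_bound a' b' (z - x) \<ge> 0)"
    if "finite F" for F :: "'n set"
    using that
  proof (induction F)
    case empty
    then show ?case using ab pos by (intro exI[of _ a] exI[of _ b]) auto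
  next
    case (insert j F)
    then obtain a' b' where ab': "\<And>i. a' i \<le> b' i" "\<And>i. a' i \<in> S" "\<And>i. b' i \<in> S"
        "\<And>i. a i \<le> a' i" "\<And>i. b' i \<le> b i" "\<And>i. i \<in> F \<Longrightarrow> a' i = b' i"
      and pos': "\<And>z. z \<in> near_points P x \<Longrightarrow> dir_bound a' b' (z - x) \<ge> 0" by blast
    obtain t where t: "t \<in> S" "a' j \<le> t" "t \<le> b' j"
      "\<And>z. z \<in> near_points P x \<Longrightarrow> dir_bound (a'(j := t)) (b'(j := t)) (z - x) \<ge> 0"
      using fix_coordinate[OF P S ab'(1-3) pos'] by blast
    have "a j \<le> t" "t \<le> b j" using order_trans[OF ab'(4) t(2)] order_trans[OF t(3) ab'(5)] .
    then show ?case
      using ab' t by (intro exI[of _ "a'(j := t)"] exI[of _ "b'(j := t)"]) (simp del: fun_upd_apply, simp)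
  qed
  from this[OF finite] obtain q b' where
    q: "\<And>i. q i \<in> S" "\<And>i. a i \<le> q i" "\<And>i. b' i \<le> b i" "\<And>i. q i = b' i"
      "\<And>z. z \<in> near_points P x \<Longrightarrow> dir_bound q b' (z - x) \<ge> 0"
    by (metis UNIV_I)
  have "b' = q" using q(4) by auto
  then have "(\<chi> i. q i) \<bullet> int_vec x \<le> (\<chi> i. q i) \<bullet> int_vec z" if "z \<in> near_points P x" for z
    using q(5)[OF that] by (simp add: dir_bound_def inner_vec_def algebra_simps sum_subtractf)
  with q show ?thesis using that[of "\<chi> i. q i"] by auto
qed

section \<open>From neighbouring points to the whole polyhedron\<close>

text \<open>A short step from \<open>x\<close> towards \<open>y\<close> stays in \<open>P\<close>
  and in the unit box around \<open>x\<close>, where box-integrality makes it a convex combination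
  of near points; a linear inequality then scales back to \<open>y\<close>.\<close>

lemma normal_on_near_points_imp_normal:
  fixes p :: "real ^ 'n"
  assumes P: "convex P" "box_integer P" and x: "x \<in> integer_points P"
    and near: "\<And>z. z \<in> near_points P x \<Longrightarrow> p \<bullet> int_vec x \<le> p \<bullet> int_vec z"
    and y: "y \<in> P"
  shows "p \<bullet> int_vec x \<le> p \<bullet> y"
proof -
  define d where "d = y - int_vec x"
  \<comment> \<open>Since \<open>\<bar>d $ i\<bar> \<le> norm d\<close>, every coordinate moves by
    at most 1; the summand 1 covers \<open>d = 0\<close> and keeps \<open>t \<le> 1\<close>.\<close>
  define t where "t = 1 / (1 + norm d)"
  have t: "0 < t" "t \<le> 1" by (auto simp: t_def add_pos_nonneg)
  have td: "\<bar>t * d $ i\<bar> \<le> 1" for i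
    using component_le_norm_cart[of d i] norm_ge_zero[of d] by (simp add: t_def abs_mult field_simps)
  let ?l = "\<chi> i. x $ i - 1" and ?u = "\<chi> i. x $ i + 1"
  let ?q = "int_vec x + t *\<^sub>R d"
  have "?q = (1 - t) *\<^sub>R int_vec x + t *\<^sub>R y" by (simp add: d_def algebra_simps)
  then have q: "?q \<in> P"
    using P(1) x y t unfolding integer_points_def convex_alt by auto
  have 1: "?l \<le> ?u" by (simp add: less_eq_vec_def)
  have "int_vec ?l $ i \<le> ?q $ i" "?q $ i \<le> int_vec ?u $ i" for i using td[of i] by simp_all
  then have 2: "int_vec ?l \<le> ?q" "?q \<le> int_vec ?u" unfolding less_eq_vec_def by blast+
  have "?q \<in> convex hull (int_vec ` {z \<in> integer_points P. ?l \<le> z \<and> z \<le> ?u})"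
    by (rule box_integer_hull[OF P(2) 1 q 2])
  moreover have "int_vec ` {z \<in> integer_points P. ?l \<le> z \<and> z \<le> ?u} \<subseteq> {y. p \<bullet> y \<ge> p \<bullet> int_vec x}"
  proof clarify
    fix z assume z: "z \<in> integer_points P" "?l \<le> z" "z \<le> ?u"
    have "\<bar>z $ i - x $ i\<bar> \<le> 1" for i
    proof -
      have "x $ i - 1 \<le> z $ i" "z $ i \<le> x $ i + 1" using z by (auto simp: less_eq_vec_def)
      then show ?thesis by linarith
    qed
    then show "p \<bullet> int_vec x \<le> p \<bullet> int_vec z" using z by (intro near) (auto simp: near_points_def)
  qed
  ultimately have "?q \<in> {y. p \<bullet> y \<ge> p \<bullet> int_vec x}"
    using hull_minimal[where S = convex, OF _ convex_halfspace_ge] by blast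
  then have "0 \<le> t * (p \<bullet> d)" by (simp add: inner_add_right)
  then have "0 \<le> p \<bullet> d" using t by (simp add: zero_le_mult_iff)
  then show ?thesis by (simp add: d_def inner_diff_right)
qed

section \<open>Discrete convex functions of one variable\<close>

lemma discrete_convexD: "discrete_convex \<phi> \<Longrightarrow> 2 * \<phi> k \<le> \<phi> (k - 1) + \<phi> (k + 1)"
  unfolding discrete_convex_def by blast

text \<open>Increments of a discrete convex function do not decrease, so a lower bound
  \<open>p\<close> on the first one bounds all later ones.\<close>

lemma discrete_convex_increments:
  assumes \<phi>: "discrete_convex \<phi>" and fin: "\<phi> k = ereal f" and p: "ereal (f + p) \<le> \<phi> (k + 1)"
  shows "ereal (f + of_nat n * p) \<le> \<phi> (k + int n)"
proof -
  have inc: "\<phi> (k + int n) + ereal p \<le> \<phi> (k + int n + 1)" for n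
  proof (induction n)
    case 0
    then show ?case using p fin by simp
  next
    case (Suc n)
    have 1: "2 * \<phi> (k + int n + 1) \<le> \<phi> (k + int n) + \<phi> (k + int n + 2)"
      using discrete_convexD[OF \<phi>, of "k + int n + 1"]
      by (simp add: add.assoc)
    have ni: "\<phi> m \<noteq> -\<infinity>" for m using \<phi> by (simp add: discrete_convex_def)
    \<comment> \<open>The inequality \<open>1\<close> is void if
      \<open>\<phi> (k + int n) = \<infinity>\<close>; then the interval shape of the domain, which
      contains \<open>k\<close>, prevents a return to finite values.\<close>
    have 2: "\<phi> (k + int n + 1) \<noteq> \<infinity>" if "\<phi> (k + int n + 2) \<noteq> \<infinity>"
    proof -
      have "{k..k + int n + 2} \<subseteq> dom_int \<phi>"
        using \<phi> that fin by (auto simp: discrete_convex_def dom_int_def)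
      moreover have "k + int n + 1 \<in> {k..k + int n + 2}" by simp
      ultimately have "k + int n + 1 \<in> dom_int \<phi>" by blast
      then show ?thesis by (simp add: dom_int_def)
    qed
    have "\<phi> (k + int n + 1) + ereal p \<le> \<phi> (k + int n + 2)"
      using 1 2 Suc ni[of "k + int n"] ni[of "k + int n + 1"] ni[of "k + int n + 2"]
      by (cases "\<phi> (k + int n)"; cases "\<phi> (k + int n + 1)"; cases "\<phi> (k + int n + 2)")
        auto
    then show ?case by (simp add: algebra_simps)
  qed
  show ?thesis
  proof (induction n)
    case 0
    then show ?case using fin by simp
  next
    case (Suc n)
    have "ereal (f + of_nat n * p) + ereal p \<le> \<phi> (k + int n) + ereal p"
      by (intro add_right_mono Suc)
    also have "\<dots> \<le> \<phi> (k + int n + 1)" by (rule inc)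
    finally show ?case by (simp add: algebra_simps)
  qed
qed

lemma discrete_convex_reflect:
  assumes "discrete_convex \<phi>" shows "discrete_convex (\<lambda>k. \<phi> (- k))"
  unfolding discrete_convex_def
proof (intro conjI allI ballI)
  fix k
  show "\<phi> (- k) \<noteq> - \<infinity>" using assms by (simp add: discrete_convex_def)
  have "2 * \<phi> (- k) \<le> \<phi> (- k - 1) + \<phi> (- k + 1)" by (rule discrete_convexD[OF assms])
  moreover have "- (k - 1) = - k + 1" "- (k + 1) = - k - 1" by simp_all
  ultimately show "2 * \<phi> (- k) \<le> \<phi> (- (k - 1)) + \<phi> (- (k + 1))" by (metis add.commute)
next
  fix a b assume ab: "a \<in> dom_int (\<lambda>k. \<phi> (- k))" "b \<in> dom_int (\<lambda>k. \<phi> (- k))"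
  then have "{-b..-a} \<subseteq> dom_int \<phi>" using assms by (auto simp: discrete_convex_def dom_int_def)
  then have "- k \<in> dom_int \<phi>" if "k \<in> {a..b}" for k using that by auto
  then show "{a..b} \<subseteq> dom_int (\<lambda>k. \<phi> (- k))" by (auto simp: dom_int_def)
qed

text \<open>The two neighbours of \<open>k\<close> decide whether \<open>p\<close> is a subgradient:
  to the right the increments are at least \<open>p\<close>, and the left half is the same argument
  for the reflected function with slope \<open>- p\<close>.\<close>

lemma discrete_convex_subgradient:
  assumes \<phi>: "discrete_convex \<phi>" and fin: "\<phi> k = ereal f"
    and p: "ereal (f + p) \<le> \<phi> (k + 1)" "ereal (f - p) \<le> \<phi> (k - 1)"
  shows "ereal (f + of_int (m - k) * p) \<le> \<phi> m"
proof (cases "m \<ge> k")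
  case True
  then show ?thesis using discrete_convex_increments[OF \<phi> fin p(1), of "nat (m - k)"] by simp
next
  case False
  then show ?thesis
    using discrete_convex_increments[OF discrete_convex_reflect[OF \<phi>], of "- k" f "- p" "nat (k - m)"] fin p(2)
    by (simp add: algebra_simps)
qed

section \<open>Existence of a dual certificate\<close>

text \<open>A normal lying between the one-sided slopes is a subgradient in each coordinate, and
  these inequalities add up. Membership in \<open>S\<close> is asked of increments, as these are
  what an integer-valued sum controls.\<close>

lemma ex_dual_certificate:
  fixes x :: "int ^ 'n"
  assumes P: "convex P" "box_integer P" and S: "real_subring S"
    and x: "x \<in> integer_points P"
    and \<phi>: "\<And>i. discrete_convex (\<phi> i)"
    and fin: "\<And>i. \<phi> i (x $ i) = ereal (f i)"
    and opt: "\<And>z. z \<in> integer_points P \<Longrightarrow> (\<Sum>i\<in>UNIV. \<phi> i (x $ i)) \<le> (\<Sum>i\<in>UNIV. \<phi> i (z $ i))"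
    and inc: "\<And>i k r. \<phi> i k = ereal r \<Longrightarrow> r - f i \<in> S"
  obtains p :: "real ^ 'n" where "\<And>i. p $ i \<in> S" "\<And>y. y \<in> P \<Longrightarrow> p \<bullet> int_vec x \<le> p \<bullet> y"
    "\<And>y. ereal (sum f UNIV + p \<bullet> (int_vec y - int_vec x)) \<le> (\<Sum>i\<in>UNIV. \<phi> i (y $ i))"
proof -
  \<comment> \<open>At an infinite value \<open>real_of_ereal\<close> gives 0 and
    \<open>g i k\<close> is \<open>- f i\<close>; this default only enlarges
    \<open>C\<close>.\<close>
  define g where "g i k = real_of_ereal (\<phi> i k) - f i" for i k
  define C where "C i = \<bar>g i (x $ i + 1)\<bar> + \<bar>g i (x $ i - 1)\<bar>" for i
  \<comment> \<open>The ceiling makes the bound an integer, hence an element of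
    \<open>S\<close>.\<close>
  define M :: real where "M = of_int \<lceil>sum C UNIV\<rceil>"
  \<comment> \<open>One-sided slopes at \<open>x\<close>, with the infinite ones truncated at a bound that dominates the
    sum of all the finite ones.\<close>
  define a where "a i = (if \<phi> i (x $ i - 1) = \<infinity> then - M else - g i (x $ i - 1))" for i
  define b where "b i = (if \<phi> i (x $ i + 1) = \<infinity> then M else g i (x $ i + 1))" for i
  have \<phi>g: "\<phi> i k = ereal (f i + g i k)" if "\<phi> i k \<noteq> \<infinity>" for i k
    using that \<phi>[of i] by (cases "\<phi> i k") (auto simp: g_def discrete_convex_def)
  have CM: "sum C UNIV \<le> M" by (simp add: M_def)
  have C0: "0 \<le> C i" for i by (simp add: C_def)
  have "C i \<le> sum C UNIV" for i by (intro member_le_sum) (auto simp: C0)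
  then have CiM: "C i \<le> M" for i using CM order_trans by blast
  have MS: "M \<in> S" using S by (auto simp: real_subring_def M_def)
  have gS: "g i k \<in> S" if "\<phi> i k \<noteq> \<infinity>" for i k
    using inc[OF \<phi>g[OF that]] by simp
  have aS: "a i \<in> S" "b i \<in> S" for i
    using MS gS real_subring_uminus[OF S] by (auto simp: a_def b_def)
  have ab: "a i \<le> b i" for i
  proof (cases "\<phi> i (x $ i - 1) = \<infinity> \<or> \<phi> i (x $ i + 1) = \<infinity>")
    case True
    then show ?thesis using CiM[of i] C0[of i] by (auto simp: a_def b_def C_def)
  next
    case False
    have "2 * \<phi> i (x $ i) \<le> \<phi> i (x $ i - 1) + \<phi> i (x $ i + 1)"
      by (rule discrete_convexD[OF \<phi>])
    then show ?thesis using False \<phi>g[of i "x $ i - 1"] \<phi>g[of i "x $ i + 1"] fin[of i]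
      by (auto simp: a_def b_def)
  qed
  have pos: "dir_bound a b (z - x) \<ge> 0" if z: "z \<in> near_points P x" for z
  proof -
    define T where "T i = max (a i * of_int ((z - x) $ i)) (b i * of_int ((z - x) $ i))" for i
    have step: "z $ i = x $ i \<or> z $ i = x $ i + 1 \<or> z $ i = x $ i - 1" for i
    proof -
      have "\<bar>z $ i - x $ i\<bar> \<le> 1" using z by (auto simp: near_points_def)
      then show ?thesis by linarith
    qed
    have g0: "g i (x $ i) = 0" for i using fin[of i] by (simp add: g_def)
    have T1: "g i (z $ i) \<le> T i" if "\<phi> i (z $ i) \<noteq> \<infinity>" for i
      using that step[of i] g0[of i] by (auto simp: T_def a_def b_def)
    have T2: "M \<le> T i" if "\<phi> i (z $ i) = \<infinity>" for i
      using that step[of i] fin[of i] by (auto simp: T_def a_def b_def)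
    have gC: "- C i \<le> g i (z $ i)" for i
      using step[of i] g0[of i] by (auto simp: C_def)
    have TC: "- C i \<le> T i" for i
      using T1[of i] T2[of i] gC[of i] CiM[of i] C0[of i] by linarith
    \<comment> \<open>Outside the domain one summand is at least \<open>M\<close>, which outweighs
      the others, each at least \<open>- C i\<close>; inside it, optimality of \<open>x\<close>
      applies.\<close>
    have "0 \<le> sum T UNIV"
    proof (cases "\<exists>i. \<phi> i (z $ i) = \<infinity>")
      case True
      then obtain j where j: "\<phi> j (z $ j) = \<infinity>" by blast
      have "- sum C (UNIV - {j}) \<le> sum T (UNIV - {j})"
        unfolding sum_negf[symmetric] by (intro sum_mono TC)
      moreover have "sum T UNIV = T j + sum T (UNIV - {j})" "sum C UNIV = C j + sum C (UNIV - {j})"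
        by (simp_all add: sum.remove)
      ultimately show ?thesis using T2[OF j] CM C0[of j] by linarith
    next
      case False
      then have "\<phi> i (z $ i) = ereal (f i + g i (z $ i))" for i using \<phi>g by blast
      moreover have "(\<Sum>i\<in>UNIV. \<phi> i (x $ i)) \<le> (\<Sum>i\<in>UNIV. \<phi> i (z $ i))"
        using z by (intro opt) (simp add: near_points_def)
      ultimately have "0 \<le> (\<Sum>i\<in>UNIV. g i (z $ i))"
        using fin by (simp add: sum.distrib)
      also have "\<dots> \<le> sum T UNIV" using False by (intro sum_mono T1) blast
      finally show ?thesis .
    qed
    then show ?thesis by (simp add: dir_bound_def T_def)
  qed
  obtain p :: "real ^ 'n" where p: "\<And>i. p $ i \<in> S" "\<And>i. a i \<le> p $ i" "\<And>i. p $ i \<le> b i"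
    "\<And>z. z \<in> near_points P x \<Longrightarrow> p \<bullet> int_vec x \<le> p \<bullet> int_vec z"
    using ex_normal_on_near_points[OF P S ab aS pos] by blast
  \<comment> \<open>At an infinite neighbour the required inequality is trivial, so truncating the
    slope does no harm.\<close>
  have "ereal (f i + of_int (m - x $ i) * p $ i) \<le> \<phi> i m" for i m
  proof (rule discrete_convex_subgradient[OF \<phi> fin])
    show "ereal (f i + p $ i) \<le> \<phi> i (x $ i + 1)"
      using p(3)[of i] \<phi>g[of i "x $ i + 1"] by (cases "\<phi> i (x $ i + 1) = \<infinity>") (auto simp: b_def)
    show "ereal (f i - p $ i) \<le> \<phi> i (x $ i - 1)"
      using p(2)[of i] \<phi>g[of i "x $ i - 1"] by (cases "\<phi> i (x $ i - 1) = \<infinity>") (auto simp: a_def)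
  qed
  then have "(\<Sum>i\<in>UNIV. ereal (f i + of_int (y $ i - x $ i) * p $ i)) \<le> (\<Sum>i\<in>UNIV. \<phi> i (y $ i))"
    for y :: "int ^ 'n" by (intro sum_mono)
  then have "ereal (sum f UNIV + p \<bullet> (int_vec y - int_vec x)) \<le> (\<Sum>i\<in>UNIV. \<phi> i (y $ i))"
    for y :: "int ^ 'n" by (simp add: sum.distrib inner_vec_def mult.commute)
  with p normal_on_near_points_imp_normal[OF P x p(4)] show ?thesis using that by blast
qed

section \<open>Weak and strong duality\<close>

text \<open>Infimum and supremum are both estimated by their term at \<open>x\<close>; finiteness of
  \<open>\<Phi> x\<close> makes the cancellation valid in \<open>ereal\<close>.\<close>

lemma weak_duality:
  assumes "x \<in> integer_points P" "\<Phi> x = ereal v"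
  shows "\<mu> P p - convex_conj \<Phi> p \<le> \<Phi> x"
proof -
  have "\<mu> P p \<le> ereal (p \<bullet> int_vec x)"
    using assms(1) unfolding \<mu>_def by (intro INF_lower) (simp add: integer_points_def)
  moreover have "ereal (p \<bullet> int_vec x) - \<Phi> x \<le> convex_conj \<Phi> p"
    unfolding convex_conj_def by (rule SUP_upper) simp
  ultimately have "\<mu> P p - convex_conj \<Phi> p \<le> ereal (p \<bullet> int_vec x) - (ereal (p \<bullet> int_vec x) - \<Phi> x)"
    by (rule ereal_minus_mono)
  then show ?thesis by (simp add: assms(2))
qed

text \<open>The point \<open>x\<close> minimizes \<open>p\<close> over \<open>P\<close> and attains
  the supremum in \<open>convex_conj \<Phi> p\<close>, so both estimates of weak duality are
  tight.\<close>

lemma strong_duality: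
  assumes x: "x \<in> integer_points P" "\<Phi> x = ereal v"
    and P: "\<And>y. y \<in> P \<Longrightarrow> p \<bullet> int_vec x \<le> p \<bullet> y"
    and \<Phi>: "\<And>y. ereal (v + p \<bullet> (int_vec y - int_vec x)) \<le> \<Phi> y"
  shows "\<mu> P p - convex_conj \<Phi> p = \<Phi> x"
proof (rule antisym)
  show "\<mu> P p - convex_conj \<Phi> p \<le> \<Phi> x" using x by (rule weak_duality)
next
  have 1: "ereal (p \<bullet> int_vec x) \<le> \<mu> P p"
    unfolding \<mu>_def by (intro INF_greatest) (simp add: P)
  have 2: "convex_conj \<Phi> p \<le> ereal (p \<bullet> int_vec x - v)"
    unfolding convex_conj_def
  proof (rule SUP_least)
    fix y
    show "ereal (p \<bullet> int_vec y) - \<Phi> y \<le> ereal (p \<bullet> int_vec x - v)"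
      using \<Phi>[of y] by (cases "\<Phi> y") (auto simp: inner_diff_right)
  qed
  have "ereal (p \<bullet> int_vec x) - ereal (p \<bullet> int_vec x - v) \<le> \<mu> P p - convex_conj \<Phi> p"
    using 1 2 by (rule ereal_minus_mono)
  then show "\<Phi> x \<le> \<mu> P p - convex_conj \<Phi> p" by (simp add: x(2))
qed

section \<open>Min-max formula over the reals and over the integers\<close>

lemma SUP_eq_attained:
  fixes F :: "'a \<Rightarrow> 'b::complete_lattice"
  assumes "\<And>p. F p \<le> v" "F q = v"
  shows "v = (SUP p. F p) \<and> (\<exists>q. F q = (SUP p. F p))"
proof -
  have "(SUP p. F p) = v" using assms by (intro antisym SUP_least SUP_upper2[of q]) auto
  then show ?thesis using assms(2) by blast
qed

theorem theorem6p2: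
  fixes P :: "(real ^ 'n) set" and \<Phi> :: "int ^ 'n \<Rightarrow> ereal"
  assumes "polyhedron P" and "P \<noteq> {}" and "box_integer P"
    and "separable_convex \<Phi>"
    and "\<bar>INF x\<in>integer_points P. \<Phi> x\<bar> \<noteq> \<infinity>"
    and "\<exists>xs\<in>integer_points P. \<Phi> xs = (INF x\<in>integer_points P. \<Phi> x)"
  shows "(INF x\<in>integer_points P. \<Phi> x) = (SUP p. \<mu> P p - convex_conj \<Phi> p)
      \<and> (\<exists>ps. \<mu> P ps - convex_conj \<Phi> ps = (SUP p. \<mu> P p - convex_conj \<Phi> p))
      \<and> (integer_valued \<Phi> \<longrightarrow>
           (INF x\<in>integer_points P. \<Phi> x)
             = (SUP p :: int ^ 'n. \<mu> P (int_vec p) - convex_conj \<Phi> (int_vec p))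
         \<and> (\<exists>ps :: int ^ 'n. \<mu> P (int_vec ps) - convex_conj \<Phi> (int_vec ps)
             = (SUP p :: int ^ 'n. \<mu> P (int_vec p) - convex_conj \<Phi> (int_vec p))))"
proof -
  obtain x where x: "x \<in> integer_points P" and xmin: "\<Phi> x = (INF x\<in>integer_points P. \<Phi> x)"
    using assms(6) by blast
  obtain \<phi> where \<phi>: "\<And>i. discrete_convex (\<phi> i)" and \<Phi>: "\<And>x. \<Phi> x = (\<Sum>i\<in>UNIV. \<phi> i (x $ i))"
    using assms(4) by (auto simp: separable_convex_def)
  have ni: "\<phi> i k \<noteq> -\<infinity>" for i k using \<phi> by (simp add: discrete_convex_def)
  have "\<Phi> x \<noteq> \<infinity>" using assms(5) xmin by auto
  then have "\<phi> i (x $ i) \<noteq> \<infinity>" for i by (simp add: \<Phi> sum_Pinfty)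
  then have "\<exists>r. \<phi> i (x $ i) = ereal r" for i using ni[of i] by (cases "\<phi> i (x $ i)") auto
  then obtain f where f: "\<And>i. \<phi> i (x $ i) = ereal (f i)" by metis
  have v: "\<Phi> x = ereal (sum f UNIV)" by (simp add: \<Phi> f)
  have conv: "convex P" using assms(1) by (rule polyhedron_imp_convex)
  have opt: "(\<Sum>i\<in>UNIV. \<phi> i (x $ i)) \<le> (\<Sum>i\<in>UNIV. \<phi> i (z $ i))" if "z \<in> integer_points P" for z
    using that xmin by (metis INF_lower \<Phi>)
  have dual: "\<exists>p. (\<forall>i. p $ i \<in> S) \<and> \<mu> P p - convex_conj \<Phi> p = \<Phi> x"
    if S: "real_subring S" and inc: "\<And>i k r. \<phi> i k = ereal r \<Longrightarrow> r - f i \<in> S" for S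
  proof -
    obtain p :: "real ^ 'n" where p: "\<And>i. p $ i \<in> S" "\<And>y. y \<in> P \<Longrightarrow> p \<bullet> int_vec x \<le> p \<bullet> y"
      "\<And>y. ereal (sum f UNIV + p \<bullet> (int_vec y - int_vec x)) \<le> (\<Sum>i\<in>UNIV. \<phi> i (y $ i))"
      using ex_dual_certificate[where \<phi> = \<phi> and f = f, OF conv assms(3) S x \<phi> f opt] inc by blast
    have "\<mu> P p - convex_conj \<Phi> p = \<Phi> x"
      using x v by (rule strong_duality) (use p \<Phi> in auto)
    with p(1) show ?thesis by blast
  qed
  have weak: "\<mu> P p - convex_conj \<Phi> p \<le> \<Phi> x" for p using x v by (rule weak_duality)
  obtain p where p: "\<mu> P p - convex_conj \<Phi> p = \<Phi> x"
    using dual[of UNIV] by (auto simp: real_subring_def)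
  have "\<exists>q :: int ^ 'n. \<mu> P (int_vec q) - convex_conj \<Phi> (int_vec q) = \<Phi> x" if iv: "integer_valued \<Phi>"
  proof -
    have "r - f i \<in> \<int>" if "\<phi> i k = ereal r" for i k r
    proof -
      \<comment> \<open>Changing only coordinate \<open>i\<close> of \<open>x\<close> turns an
        increment of \<open>\<phi> i\<close> into a difference of two values of
        \<open>\<Phi>\<close>; single values of \<open>\<phi> i\<close> may be non-integral.\<close>
      let ?y = "\<chi> l. if l = i then k else x $ l"
      have "\<Phi> ?y = \<phi> i k + (\<Sum>l\<in>UNIV - {i}. \<phi> l (x $ l))"
        unfolding \<Phi> by (subst sum.remove[of _ i]) auto
      then have "\<Phi> ?y = ereal (r + sum f (UNIV - {i}))" using that f by simp
      moreover have "sum f UNIV = f i + sum f (UNIV - {i})" by (simp add: sum.remove)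
      ultimately have y: "\<Phi> ?y = ereal (sum f UNIV + (r - f i))" by simp
      obtain m :: int where "\<Phi> ?y = ereal m" using iv y unfolding integer_valued_def by (metis PInfty_neq_ereal(1))
      moreover obtain m' :: int where "\<Phi> x = ereal m'" using iv v unfolding integer_valued_def by (metis PInfty_neq_ereal(1))
      ultimately have "r - f i = of_int (m - m')" using y v by simp
      then show ?thesis by (metis Ints_of_int)
    qed
    then obtain q where q: "\<forall>i. q $ i \<in> \<int>" "\<mu> P q - convex_conj \<Phi> q = \<Phi> x"
      using dual[of "\<int>"] by (auto simp: real_subring_def)
    have "q = int_vec (\<chi> i. \<lfloor>q $ i\<rfloor>)" using q(1) by (simp add: vec_eq_iff of_int_floor)
    with q(2) show ?thesis by metis
  qed
  then show ?thesis
    unfolding xmin[symmetric]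
    using SUP_eq_attained[where F = "\<lambda>p. \<mu> P p - convex_conj \<Phi> p" and v = "\<Phi> x"]
      SUP_eq_attained[where F = "\<lambda>q. \<mu> P (int_vec q) - convex_conj \<Phi> (int_vec q)" and v = "\<Phi> x"]
      p weak by blast
qed

end
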